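(* For all integers $n>k\ge 0$, \[ S(n,k)=\binom{n}{k}\sum_{\ell=1}^{n-k}(-1)^{\ell}\frac{\binom{k}{\ell}}{\binom{n-k+\ell}{n-k}}\sum_{i=0}^{\ell}(-1)^{i}\binom{n-k+\ell}{\ell-i}S(n-k+i,i) \] and \[ S(n,k)=(-1)^n\sum_{i=2k-n}^{k-1}(-1)^{i}\binom{n}{i}\binom{i-1}{2k-n-1}S(n-i,k-i). \]
   Context: $S(n,k)$ denotes the Stirling number of the second kind, i.e. the number of ways to partition an $n$-element set into $k$ nonempty subsets; equivalently $S(n,k)=\frac1{k!}\sum_{i=0}^k(-1)^i\binom{k}{i}(k-i)^n$, or $\frac{(e^x-1)^k}{k!}=\sum_{n=k}^\infty S(n,k)\frac{x^n}{n!}$ for integers $k\ge 0$. In particular $S(0,0)=1$, $S(n,0)=0$ for $n\ge1$, and $S(n,k)=0$ for $k>n$. The binomial coefficient conventions $\binom00=1$, $\binom{-1}{-1}=1$, and $\binom{p}{q}=0$ whenever $p\ge 0>q$ are adopted. *)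

theory Defs
  imports Complex_Main "HOL-Combinatorics.Stirling"
begin

text \<open>
  Binomial coefficients with two integer arguments. For a nonnegative lower argument
  this is the usual falling-factorial definition. For a negative lower argument it is the
  standard extension by the symmetry rule $\binom{p}{q} = \binom{p}{p-q}$, with value $0$ if
  $p - q < 0$ as well. In particular $\binom{-1}{-1} = 1$, $\binom{p}{q} = 0$ for
  $p \ge 0 > q$, and $\binom{-1}{-m} = (-1)^{m-1}$ for $m \ge 1$; see the lemmas below.
\<close>

definition int_binomial :: "int \<Rightarrow> int \<Rightarrow> real" where
  "int_binomial p q =
     (if q \<ge> 0 then of_int p gchoose nat q
      else if p - q \<ge> 0 then of_int p gchoose nat (p - q)
      else 0)"

lemma int_binomial_of_nat: "int_binomial (int n) (int k) = real (n choose k)"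
  by (simp add: int_binomial_def binomial_gbinomial)

lemma int_binomial_0_0: "int_binomial 0 0 = 1"
  by (simp add: int_binomial_def)

lemma int_binomial_minus1_minus1: "int_binomial (- 1) (- 1) = 1"
  by (simp add: int_binomial_def)

lemma int_binomial_neg_lower:
  assumes "p \<ge> 0" and "q < 0"
  shows "int_binomial p q = 0"
proof -
  have "int_binomial p q = real (nat p choose nat (p - q))"
    using assms by (simp add: int_binomial_def binomial_gbinomial)
  also have "nat p < nat (p - q)"
    using assms by simp
  hence "nat p choose nat (p - q) = 0"
    by simp
  finally show ?thesis
    by simp
qed

lemma int_binomial_minus1_neg: "int_binomial (- 1) (- int (Suc m)) = (- 1) ^ m"
  using gbinomial_minus[of "1::real" m]
  by (simp add: int_binomial_def binomial_gbinomial[symmetric, where 'a = real])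

end

theory Submission
  imports Defs
begin

text \<open>
  Put $m = n - k$ and let $a(m,j)$ be the number of partitions of an $(m+j)$-element set into
  $j$ blocks of size at least $2$. Choosing the singleton blocks of a partition first gives
  $S(n,k) = \sum_{j \le m} \binom{n}{m+j} a(m,j)$, since $a(m,j) = 0$ for $j > m$. Binomial inversion
  expresses $a(m,l)$ through the numbers $S(m+i,i)$, which is the first formula. Interchanging the
  two sums and evaluating the inner one, a partial alternating row sum of binomial coefficients,
  gives the second.
\<close>

section \<open>Associated Stirling numbers and the expansion by singleton blocks\<close>

text \<open>In the last equation one element is singled out among \<open>m + j + 2\<close>: either
  it joins one of the \<open>Suc j\<close> blocks of a partition of the rest, or it forms a pair
  with one of the other \<open>Suc (m + j)\<close> elements.\<close>

fun assoc_Stirling :: "nat \<Rightarrow> nat \<Rightarrow> nat" where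
  "assoc_Stirling 0 j = (if j = 0 then 1 else 0)"
| "assoc_Stirling (Suc m) 0 = 0"
| "assoc_Stirling (Suc m) (Suc j) =
     Suc j * assoc_Stirling m (Suc j) + Suc (m + j) * assoc_Stirling m j"

lemma assoc_Stirling_eq_0: "m < j \<Longrightarrow> assoc_Stirling m j = 0"
  by (induction m j rule: assoc_Stirling.induct) auto

lemma Suc_times_binomial_Suc: "Suc r * (n choose Suc r) = (n - r) * (n choose r)"
  using binomial_absorb_comp[of n r] binomial_absorption[of r n] by simp

text \<open>After the recurrence and an index shift, \<open>assoc_Stirling m j\<close> has the
  coefficient computed in \<open>absorb\<close>. The right-hand side supplies the term
  \<open>i * Stirling (m + i) i\<close> of the Stirling recurrence.\<close>

lemma sum_assoc_Stirling_Suc: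
  "(\<Sum>j\<le>Suc m. assoc_Stirling (Suc m) j * ((m + i) choose (m + j))) =
     i * (\<Sum>j\<le>m. assoc_Stirling m j * ((m + i) choose (m + j)))"
proof -
  let ?c = "\<lambda>j. (m + i) choose (m + j)" and ?a = "assoc_Stirling m"
  \<comment> \<open>The extra term \<open>j = 0\<close> has factor 0, and the term
    \<open>j = Suc m\<close> vanishes by \<open>assoc_Stirling_eq_0\<close>.\<close>
  have shift: "(\<Sum>j\<le>m. Suc j * ?a (Suc j) * ?c (Suc j)) = (\<Sum>j\<le>m. j * ?a j * ?c j)"
  proof -
    have "(\<Sum>j\<le>m. Suc j * ?a (Suc j) * ?c (Suc j)) = (\<Sum>j\<le>Suc m. j * ?a j * ?c j)"
      by (subst sum.atMost_Suc_shift) simp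
    also have "\<dots> = (\<Sum>j\<le>m. j * ?a j * ?c j)"
      by (simp add: assoc_Stirling_eq_0)
    finally show ?thesis .
  qed
  have absorb: "j * ?c j + Suc (m + j) * ?c (Suc j) = i * ?c j" for j
  proof (cases "j \<le> i")
    case True
    then have "j * ?c j + (i - j) * ?c j = i * ?c j"
      by (metis add_mult_distrib le_add_diff_inverse)
    with Suc_times_binomial_Suc[of "m + j" "m + i"] show ?thesis by simp
  next
    case False
    then show ?thesis by (simp add: binomial_eq_0)
  qed
  have "(\<Sum>j\<le>Suc m. assoc_Stirling (Suc m) j * ?c j) =
      (\<Sum>j\<le>m. Suc j * ?a (Suc j) * ?c (Suc j)) + (\<Sum>j\<le>m. Suc (m + j) * ?a j * ?c (Suc j))"
    by (subst sum.atMost_Suc_shift)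
      (simp only: assoc_Stirling.simps mult_zero_left add_0 add_mult_distrib sum.distrib)
  also have "\<dots> = (\<Sum>j\<le>m. ?a j * (j * ?c j + Suc (m + j) * ?c (Suc j)))"
    unfolding shift by (simp only: sum.distrib add_mult_distrib2 mult_ac)
  also have "\<dots> = i * (\<Sum>j\<le>m. ?a j * ?c j)"
    unfolding absorb by (simp only: sum_distrib_left mult_ac)
  finally show ?thesis .
qed

text \<open>In the Stirling recurrence one term falls to the induction on \<open>m\<close>, the
  other to the induction on \<open>i\<close>; Pascal's rule merges the two sums.\<close>

lemma Stirling_eq_sum_assoc_Stirling:
  "Stirling (m + i) i = (\<Sum>j\<le>m. assoc_Stirling m j * ((m + i) choose (m + j)))"
proof (induction m arbitrary: i)
  case 0
  show ?case by simp
next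
  case (Suc m)
  show ?case
  proof (induction i)
    case 0
    have "assoc_Stirling (Suc m) j * ((Suc m + 0) choose (Suc m + j)) = 0" for j
      by (cases j) (simp_all add: binomial_eq_0)
    then show ?case by simp
  next
    case (Suc i)
    let ?a = "assoc_Stirling (Suc m)" and ?N = "m + Suc i"
    have "Stirling (Suc m + Suc i) (Suc i) = Suc i * Stirling ?N (Suc i) + Stirling (Suc m + i) i"
      by simp
    also have "\<dots> = (\<Sum>j\<le>Suc m. ?a j * (?N choose (m + j))) +
        (\<Sum>j\<le>Suc m. ?a j * (?N choose (Suc m + j)))"
      \<comment> \<open>\<open>Suc.IH\<close> is the hypothesis of the inner induction; the outer
        one is quoted literally and used at \<open>Suc i\<close>.\<close>
      unfolding Suc.IH \<open>\<And>i. Stirling (m + i) i = _\<close> sum_assoc_Stirling_Suc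
      by (simp only: add_Suc add_Suc_right)
    also have "\<dots> = (\<Sum>j\<le>Suc m. ?a j * (Suc ?N choose (Suc m + j)))"
      by (simp only: sum.distrib[symmetric] add_mult_distrib2[symmetric] add_Suc binomial_Suc_Suc)
    finally show ?case by (simp only: add_Suc)
  qed
qed

section \<open>Alternating sums of products of binomial coefficients\<close>

text \<open>Trinomial revision also for \<open>s > n\<close>, where both sides vanish; the sums
  below may run past \<open>n\<close>.\<close>

lemma choose_mult_le:
  assumes "r \<le> s"
  shows "(n choose s) * (s choose r) = (n choose r) * ((n - r) choose (s - r))"
proof (cases "s \<le> n")
  case True
  with assms show ?thesis by (rule choose_mult)
next
  case False
  then show ?thesis by (cases "r \<le> n") (simp_all add: binomial_eq_0)
qed

text \<open>Trinomial revision extracts \<open>n choose r\<close> and leaves a partial alternating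
  sum of row \<open>n - r\<close>. The result needs \<open>gchoose\<close>, as its upper entry is -1
  for \<open>n = r\<close>.\<close>

lemma alternating_sum_choose_mult:
  assumes "r \<le> t"
  shows "(\<Sum>s = r..t. (- 1) ^ s * real (n choose s) * real (s choose r)) =
    (- 1) ^ t * real (n choose r) * ((real n - real r - 1) gchoose (t - r))"
proof (cases "r \<le> n")
  case True
  have "(\<Sum>s = r..t. (- 1) ^ s * real (n choose s) * real (s choose r)) =
      (\<Sum>u\<le>t - r. (- 1) ^ (u + r) * (real (n choose (u + r)) * real ((u + r) choose r)))"
    using assms sum.shift_bounds_cl_nat_ivl[of _ 0 r "t - r"]
    by (simp add: atMost_atLeast0 mult.assoc)
  also have "\<dots> = (\<Sum>u\<le>t - r. (- 1) ^ r * real (n choose r) *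
      (((real n - real r) gchoose u) * (- 1) ^ u))"
    using True
    by (intro sum.cong refl)
      (simp add: of_nat_mult[symmetric] choose_mult_le del: of_nat_mult,
       simp add: power_add binomial_gbinomial of_nat_diff)
  also have "\<dots> = (- 1) ^ r * real (n choose r) *
      ((- 1) ^ (t - r) * ((real n - real r - 1) gchoose (t - r)))"
    by (simp only: sum_distrib_left[symmetric] gbinomial_sum_lower_neg)
  also have "\<dots> = (- 1) ^ (r + (t - r)) * real (n choose r) *
      ((real n - real r - 1) gchoose (t - r))"
    by (simp only: power_add mult_ac)
  finally show ?thesis using assms by simp
next
  case False
  then show ?thesis by (simp add: binomial_eq_0)
qed

lemma alternating_sum_choose_mult_shift:
  assumes "i \<le> t"
  shows "(\<Sum>l = i..t. (- 1) ^ l * real (n choose (m + l)) * real ((m + l) choose (m + i))) =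
    (- 1) ^ t * real (n choose (m + i)) * ((real n - real (m + i) - 1) gchoose (t - i))"
proof -
  \<comment> \<open>The factor \<open>(- 1) ^ m\<close> completes the sign to
    \<open>(- 1) ^ s\<close> with \<open>s = m + l\<close>, and cancels at the end.\<close>
  have "(- 1) ^ m * (\<Sum>l = i..t. (- 1) ^ l * real (n choose (m + l)) * real ((m + l) choose (m + i)))
      = (\<Sum>s = m + i..m + t. (- 1) ^ s * real (n choose s) * real (s choose (m + i)))"
    using sum.shift_bounds_cl_nat_ivl
        [of "\<lambda>s. (- 1) ^ s * real (n choose s) * real (s choose (m + i))" i m t]
    by (simp add: sum_distrib_left power_add add.commute[of _ m] mult.assoc)
  also have "\<dots> = (- 1) ^ m * ((- 1) ^ t * real (n choose (m + i)) *
      ((real n - real (m + i) - 1) gchoose (t - i)))"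
    using assms by (subst alternating_sum_choose_mult) (simp_all add: power_add)
  finally show ?thesis by simp
qed

section \<open>Binomial inversion and its consequence for Stirling numbers\<close>

text \<open>Expanding each \<open>Stirling (m + i) i\<close> and summing over \<open>i\<close> first
  leaves the orthogonality relation \<open>inversion\<close>, which selects
  \<open>j = l\<close>.\<close>

lemma assoc_Stirling_eq_sum_Stirling:
  "real (assoc_Stirling m l) =
     (- 1) ^ l * (\<Sum>i = 0..l. (- 1) ^ i * real ((m + l) choose (l - i)) * real (Stirling (m + i) i))"
proof -
  let ?a = "\<lambda>j. real (assoc_Stirling m j)"
  have inversion: "(\<Sum>i = 0..l. (- 1) ^ i * real ((m + l) choose (m + i)) *
      real ((m + i) choose (m + j))) = (if j = l then (- 1) ^ l else 0)" for j
  proof (cases "j \<le> l")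
    case True
    have "(\<Sum>i = 0..l. (- 1) ^ i * real ((m + l) choose (m + i)) * real ((m + i) choose (m + j)))
        = (\<Sum>i = j..l. (- 1) ^ i * real ((m + l) choose (m + i)) * real ((m + i) choose (m + j)))"
      by (intro sum.mono_neutral_right) (auto simp: binomial_eq_0)
    also have "\<dots> = (- 1) ^ l * real ((m + l) choose (m + j)) *
        ((real (l - j) - 1) gchoose (l - j))"
      using True by (subst alternating_sum_choose_mult_shift) (simp_all add: of_nat_diff)
    \<comment> \<open>For \<open>j < l\<close> the upper entry is the natural number
      \<open>l - j - 1\<close>, one less than the lower entry.\<close>
    also have "\<dots> = (if j = l then (- 1) ^ l else 0)"
    proof (cases "j = l")
      case False
      with True obtain d where "l - j = Suc d"
        by (metis Suc_diff_Suc le_neq_implies_less)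
      then show ?thesis
        using False by (simp add: binomial_gbinomial[symmetric] binomial_eq_0)
    qed simp
    finally show ?thesis .
  next
    case False
    then show ?thesis by (auto intro!: sum.neutral simp: binomial_eq_0)
  qed
  have "(\<Sum>i = 0..l. (- 1) ^ i * real ((m + l) choose (l - i)) * real (Stirling (m + i) i)) =
      (\<Sum>i = 0..l. \<Sum>j\<le>m. ?a j * ((- 1) ^ i * real ((m + l) choose (m + i)) *
         real ((m + i) choose (m + j))))"
  proof (intro sum.cong refl)
    fix i assume "i \<in> {0..l}"
    then have "(m + l) choose (l - i) = (m + l) choose (m + i)"
      by (subst binomial_symmetric) auto
    then show "(- 1) ^ i * real ((m + l) choose (l - i)) * real (Stirling (m + i) i) =
      (\<Sum>j\<le>m. ?a j * ((- 1) ^ i * real ((m + l) choose (m + i)) * real ((m + i) choose (m + j))))"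
      by (simp add: Stirling_eq_sum_assoc_Stirling sum_distrib_left mult_ac)
  qed
  also have "\<dots> = (\<Sum>j\<le>m. ?a j * (if j = l then (- 1) ^ l else 0))"
    by (subst sum.swap) (simp only: sum_distrib_left[symmetric] inversion)
  \<comment> \<open>For \<open>l > m\<close> no index \<open>j\<close> equals \<open>l\<close>, but
    then \<open>?a l\<close> is 0 too.\<close>
  also have "\<dots> = (- 1) ^ l * ?a l"
    by (auto simp: if_distrib assoc_Stirling_eq_0 cong: if_cong)
  finally show ?thesis by simp
qed

text \<open>The inverted formula goes into the singleton expansion; with the sums interchanged, the
  inner sum over \<open>l\<close> is \<open>alternating_sum_choose_mult_shift\<close> with
  \<open>n = m + k\<close> and \<open>t = m\<close>.\<close>

lemma Stirling_eq_alternating_sum: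
  "real (Stirling (m + k) k) = (\<Sum>i\<le>m. (- 1) ^ (m + i) * real ((m + k) choose (m + i)) *
     ((real k - real i - 1) gchoose (m - i)) * real (Stirling (m + i) i))"
proof -
  have "real (Stirling (m + k) k) = (\<Sum>l = 0..m. \<Sum>i = 0..l. (- 1) ^ i * real (Stirling (m + i) i) *
      ((- 1) ^ l * real ((m + k) choose (m + l)) * real ((m + l) choose (m + i))))"
    unfolding Stirling_eq_sum_assoc_Stirling[of m k] of_nat_sum of_nat_mult atMost_atLeast0
  proof (intro sum.cong refl)
    fix l
    have "(m + l) choose (l - i) = (m + l) choose (m + i)" if "i \<le> l" for i
      using that by (subst binomial_symmetric) auto
    then have "real (assoc_Stirling m l) =
        (- 1) ^ l * (\<Sum>i = 0..l. (- 1) ^ i * real ((m + l) choose (m + i)) * real (Stirling (m + i) i))"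
      by (simp add: assoc_Stirling_eq_sum_Stirling)
    then show "real (assoc_Stirling m l) * real ((m + k) choose (m + l)) =
      (\<Sum>i = 0..l. (- 1) ^ i * real (Stirling (m + i) i) *
        ((- 1) ^ l * real ((m + k) choose (m + l)) * real ((m + l) choose (m + i))))"
      by (simp add: sum_distrib_left sum_distrib_right mult_ac)
  qed
  also have "\<dots> = (\<Sum>i = 0..m. \<Sum>l = i..m. (- 1) ^ i * real (Stirling (m + i) i) *
      ((- 1) ^ l * real ((m + k) choose (m + l)) * real ((m + l) choose (m + i))))"
    \<comment> \<open>Both sides become sums over pairs from the triangle
      \<open>i \<le> l \<le> m\<close>, matched by swapping coordinates.\<close>
    unfolding sum.Sigma[OF finite_atLeastAtMost ballI[OF finite_atLeastAtMost]]
    by (rule sum.reindex_bij_witness[where i = prod.swap and j = prod.swap]) auto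
  also have "\<dots> = (\<Sum>i = 0..m. (- 1) ^ (m + i) * real ((m + k) choose (m + i)) *
      ((real k - real i - 1) gchoose (m - i)) * real (Stirling (m + i) i))"
    by (intro sum.cong refl, simp only: sum_distrib_left[symmetric],
        subst alternating_sum_choose_mult_shift) (simp_all add: power_add)
  finally show ?thesis by (simp only: atMost_atLeast0)
qed

section \<open>Quotients and integer arguments in binomial coefficients\<close>

text \<open>Trinomial revision again, divided by the positive \<open>(m + l) choose m\<close>; it
  accounts for the quotient in the first formula.\<close>

lemma choose_mult_divide_choose:
  "real ((m + k) choose k) * (real (k choose l) / real ((m + l) choose m)) =
     real ((m + k) choose (m + l))"
proof -
  have "((m + k) choose (m + l)) * ((m + l) choose m) = ((m + k) choose k) * (k choose l)"
    using choose_mult_le[of m "m + l" "m + k"] binomial_symmetric[of k "m + k"] by simp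
  then have "real ((m + k) choose (m + l)) * real ((m + l) choose m) =
      real ((m + k) choose k) * real (k choose l)"
    by (simp only: of_nat_mult[symmetric])
  then show ?thesis by (simp add: field_simps)
qed

lemma int_binomial_diff:
  "int_binomial (int (m + k)) (int k - int i) = real ((m + k) choose (m + i))"
proof (cases "i \<le> k")
  case True
  then have "int_binomial (int (m + k)) (int k - int i) = real ((m + k) choose (k - i))"
    by (simp add: int_binomial_of_nat of_nat_diff[symmetric] del: of_nat_add of_nat_diff)
  also have "(m + k) choose (k - i) = (m + k) choose (m + i)"
    using True by (subst binomial_symmetric) auto
  finally show ?thesis .
next
  case False
  then show ?thesis by (simp add: int_binomial_neg_lower binomial_eq_0)
qed

text \<open>The symmetry rule fails for a negative upper and a nonnegative lower argument, which would mean
  \<open>m < k \<le> i\<close> here.\<close>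

lemma int_binomial_symmetric:
  assumes "i \<le> k" "i \<le> m"
  shows "int_binomial (int k - int i - 1) (int k - int m - 1) =
    (real k - real i - 1) gchoose (m - i)"
proof (cases "m < k")
  case True
  with assms have "int k - int i - 1 = int (k - i - 1)" "int k - int m - 1 = int (k - m - 1)"
    by auto
  then have "int_binomial (int k - int i - 1) (int k - int m - 1) =
      int_binomial (int (k - i - 1)) (int (k - m - 1))"
    by (simp only:)
  also have "\<dots> = real ((k - i - 1) choose (k - m - 1))"
    by (rule int_binomial_of_nat)
  also have "(k - i - 1) choose (k - m - 1) = (k - i - 1) choose (m - i)"
    using True assms by (subst binomial_symmetric) auto
  finally show ?thesis
    using True assms by (simp add: binomial_gbinomial of_nat_diff diff_diff_eq add.commute)
next
  \<comment> \<open>The lower argument is negative here, so \<open>int_binomial_def\<close> itself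
    applies the symmetry rule.\<close>
  case False
  moreover have "nat (int k - int i - 1 - (int k - int m - 1)) = m - i"
    by simp
  ultimately show ?thesis
    using assms by (simp add: int_binomial_def)
qed

section \<open>Transfer to the index ranges of the two formulas\<close>

theorem theorem2p1:
  fixes n k :: nat
  assumes "n > k"
  shows "real (Stirling n k) =
      real (n choose k) *
        (\<Sum>l = 1..n - k. (- 1) ^ l *
           (real (k choose l) / real ((n - k + l) choose (n - k))) *
           (\<Sum>i = 0..l. (- 1) ^ i * real ((n - k + l) choose (l - i)) *
              real (Stirling (n - k + i) i)))
    \<and> real (Stirling n k) =
      (- 1) ^ n *
        (\<Sum>i = 2 * int k - int n..int k - 1. (- 1) powi i *
           int_binomial (int n) i * int_binomial (i - 1) (2 * int k - int n - 1) *
           real (Stirling (nat (int n - i)) (nat (int k - i))))"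
proof -
  define m where "m = n - k"
  with assms have n: "n = m + k" and m: "m > 0"
    by auto
  have nk: "m + k - k = m" by simp
  have "real (Stirling (m + k) k) = (\<Sum>l\<le>m. real (assoc_Stirling m l) * real ((m + k) choose (m + l)))"
    by (simp add: Stirling_eq_sum_assoc_Stirling)
  also have "\<dots> = (\<Sum>l = 1..m. real (assoc_Stirling m l) * real ((m + k) choose (m + l)))"
  \<comment> \<open>The term \<open>l = 0\<close> drops out because
    \<open>assoc_Stirling m 0\<close> is 0 for \<open>m > 0\<close>.\<close>
  proof (rule sum.mono_neutral_right)
    show "\<forall>l\<in>{..m} - {1..m}. real (assoc_Stirling m l) * real ((m + k) choose (m + l)) = 0"
      using m by (cases m) (auto simp: not_le)
  qed auto
  also have "\<dots> = real ((m + k) choose k) *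
      (\<Sum>l = 1..m. (- 1) ^ l * (real (k choose l) / real ((m + l) choose m)) *
        (\<Sum>i = 0..l. (- 1) ^ i * real ((m + l) choose (l - i)) * real (Stirling (m + i) i)))"
    unfolding assoc_Stirling_eq_sum_Stirling choose_mult_divide_choose[symmetric]
      sum_distrib_left[of "real ((m + k) choose k)"]
    by (simp only: mult_ac)
  finally have first: "real (Stirling (m + k) k) = \<dots>" .

  have "real (Stirling (m + k) k) = (\<Sum>i\<le>m. (- 1) ^ (m + i) * real ((m + k) choose (m + i)) *
     ((real k - real i - 1) gchoose (m - i)) * real (Stirling (m + i) i))"
    by (rule Stirling_eq_alternating_sum)
  also have "\<dots> = (\<Sum>i = 1..m. (- 1) ^ (m + i) * real ((m + k) choose (m + i)) *
     ((real k - real i - 1) gchoose (m - i)) * real (Stirling (m + i) i))"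
  \<comment> \<open>Likewise \<open>Stirling m 0\<close> is 0 for \<open>m > 0\<close>.\<close>
  proof (rule sum.mono_neutral_right)
    show "\<forall>i\<in>{..m} - {1..m}. (- 1) ^ (m + i) * real ((m + k) choose (m + i)) *
        ((real k - real i - 1) gchoose (m - i)) * real (Stirling (m + i) i) = 0"
      using m by (cases m) (auto simp: not_le)
  qed auto
  also have "\<dots> = (\<Sum>i = 2 * int k - int (m + k)..int k - 1. (- 1) ^ (m + k) * ((- 1) powi i *
      int_binomial (int (m + k)) i * int_binomial (i - 1) (2 * int k - int (m + k) - 1) *
      real (Stirling (nat (int (m + k) - i)) (nat (int k - i)))))"
  \<comment> \<open>The index becomes \<open>k - i\<close>: the ends \<open>i = 1\<close> and
    \<open>i = m\<close> go to \<open>k - 1\<close> and \<open>k - m\<close>, which is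
    \<open>2 * k - n\<close>.\<close>
  proof (rule sum.reindex_bij_witness[where i = "\<lambda>i. nat (int k - i)" and j = "\<lambda>i. int k - int i"])
    fix i assume i: "i \<in> {1..m}"
    have args: "nat (int (m + k) - (int k - int i)) = m + i" "nat (int k - (int k - int i)) = i"
      "2 * int k - int (m + k) - 1 = int k - int m - 1"
      by auto
    show "(- 1) ^ (m + k) * ((- 1) powi (int k - int i) *
        int_binomial (int (m + k)) (int k - int i) *
        int_binomial (int k - int i - 1) (2 * int k - int (m + k) - 1) *
        real (Stirling (nat (int (m + k) - (int k - int i))) (nat (int k - (int k - int i))))) =
      (- 1) ^ (m + i) * real ((m + k) choose (m + i)) *
        ((real k - real i - 1) gchoose (m - i)) * real (Stirling (m + i) i)"
    \<comment> \<open>For \<open>i > k\<close>, where the symmetry rule may fail, the first binomial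
      coefficient on each side is 0.\<close>
    proof (cases "i \<le> k")
      case True
      then have "(- 1 :: real) powi (int k - int i) = (- 1) ^ (k - i)"
        by (simp add: of_nat_diff[symmetric] del: of_nat_diff)
      \<comment> \<open>The exponents differ by the even number \<open>2 * (k - i)\<close>.\<close>
      moreover have "(- 1 :: real) ^ (m + k) * (- 1) ^ (k - i) = (- 1) ^ (m + i)"
        using True by (auto simp: power_add[symmetric] minus_one_power_iff)
      ultimately show ?thesis
        unfolding args int_binomial_diff
        using True i by (simp add: int_binomial_symmetric mult.assoc[symmetric])
    next
      case False
      then show ?thesis by (simp add: int_binomial_neg_lower binomial_eq_0)
    qed
  qed auto
  finally have second: "real (Stirling (m + k) k) = \<dots>" .
  show ?thesis
    unfolding n nk sum_distrib_left[symmetric, of "(- 1) ^ (m + k)"]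
    using first second[unfolded sum_distrib_left[symmetric]] by blast
qed

end
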